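(* Let $w$ be a weight vector and grade $S=\mathbb{K}[x_1,\dots,x_n]$ by $\deg(x_i)=w_i$. Let $m\in S$ be a monomial of (weighted) degree $d$, let $I=\overline{m}$ be the principal $w$-stable ideal generated by $m$, and for $0\le s\le d-1$ let $k_s=\max(trunc_{s+1}(\psi(m)))$. Then the Hilbert series of $S/I$ is $$HS(S/I)=\sum_{s=0}^{d-1}\frac{c_s t^s}{\prod_{j=k_s+1}^{n}(1-t^{w_j})},$$ where $c_s$ is the cardinality of $\psi^{-1}(G_s)$, the set of monomials $u\in S$ with $\psi(u)\in G_s$, and $G_s$ is the set of degree $s$ minimal monomial generators of $trunc_s(Borel(\psi(m)))$ that do not lie in $Borel(\psi(m))$.
   Context: Let $\mathbb{K}$ be a field, $S=\mathbb{K}[x_1,\dots,x_n]$, $R=\mathbb{K}[y_1,\dots,y_n]$ ($R$ with the standard grading). A weight vector is $w=(w_1,\dots,w_n)$ of positive integers with $w_1\ge w_2\ge\dots\ge w_n$. Let $\psi:S\to R$ be the $\mathbb{K}$-algebra homomorphism with $\psi(x_i)=y_i^{w_i}$. A Borel move on a monomial $m\in R$ sends $m$ to $m\cdot\frac{y_{i_1}}{y_{j_1}}\cdots\frac{y_{i_s}}{y_{j_s}}$, where $i_t<j_t$ for all $t$ and $y_{j_1}\cdots y_{j_s}$ divides $m$. A monomial ideal of $R$ is strongly stable if it is closed under Borel moves on its monomials. $Borel(\mu)$ is the smallest strongly stable ideal of $R$ containing the monomial $\mu$. For a monomial $m\in S$, $\overline{m}:=\psi^{-1}(Borel(\psi(m)))$.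 For a monomial $\mu=y_{i_1}\cdots y_{i_r}$ with $i_1\le\dots\le i_r$ and an integer $e\ge 0$, $trunc_e(\mu)=y_{i_1}\cdots y_{i_e}$ if $e\le r$, and $trunc_e(\mu)=\mu$ if $e>r$. For a monomial ideal $J\subset R$, $trunc_e(J)$ is the ideal generated by $trunc_e(\mu)$ for all monomials $\mu\in J$. For a monomial $\mu\ne1$, $\max(\mu)$ is the largest index of a variable dividing $\mu$. $HS(S/I)=\sum_i \dim_{\mathbb{K}}(S/I)_i\,t^i$ with respect to the weighted grading. *)

theory Defs
  imports
    "HOL-Library.Poly_Mapping"
    "HOL-Computational_Algebra.Formal_Power_Series"
    "HOL-Algebra.QuotRing"
    "Jordan_Normal_Form.VS_Connect"
begin

text \<open>
  The variables are indexed by a finite linear order \<open>'n\<close>, which plays the role of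
  \<open>{1 < \<dots> < n}\<close>.  An exponent vector is an element of \<open>'n \<Rightarrow>\<^sub>0 nat\<close>, written additively;
  the polynomial rings \<open>S\<close> and \<open>R\<close> are two copies of the monoid algebra on these vectors.
\<close>

type_synonym 'n expo = "'n \<Rightarrow>\<^sub>0 nat"
type_synonym ('n, 'k) mpoly = "'n expo \<Rightarrow>\<^sub>0 'k"

definition mon :: "'n expo \<Rightarrow> ('n, 'k::comm_ring_1) mpoly" where
  "mon u = Poly_Mapping.single u 1"

definition cst :: "'k \<Rightarrow> ('n, 'k::comm_ring_1) mpoly" where
  "cst a = Poly_Mapping.single 0 a"

definition var :: "'n \<Rightarrow> ('n, 'k::comm_ring_1) mpoly" where
  "var i = mon (Poly_Mapping.single i 1)"

definition weight_vector :: "('n::linorder \<Rightarrow> nat) \<Rightarrow> bool" where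
  "weight_vector w \<longleftrightarrow> (\<forall>i. w i > 0) \<and> antimono w"

definition wdeg :: "('n::finite \<Rightarrow> nat) \<Rightarrow> 'n expo \<Rightarrow> nat" where
  "wdeg w u = (\<Sum>i\<in>UNIV. w i * Poly_Mapping.lookup u i)"

abbreviation tdeg :: "'n::finite expo \<Rightarrow> nat" where
  "tdeg \<equiv> wdeg (\<lambda>_. 1)"

text \<open>\<open>\<psi>\<close> is evaluation at \<open>x\<^sub>i = y\<^sub>i ^ w\<^sub>i\<close>; that it is a \<open>\<bbbK>\<close>-algebra homomorphism is shown in
  \<open>psi_add\<close>, \<open>psi_mult\<close>, \<open>psi_cst\<close> and \<open>psi_var\<close> below.\<close>

definition psi :: "('n::finite \<Rightarrow> nat) \<Rightarrow> ('n, 'k::comm_ring_1) mpoly \<Rightarrow> ('n, 'k) mpoly" where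
  "psi w f = (\<Sum>u\<in>Poly_Mapping.keys f. cst (Poly_Mapping.lookup f u) *
     (\<Prod>i\<in>UNIV. (var i ^ w i) ^ Poly_Mapping.lookup u i))"

text \<open>The exponent vector of \<open>\<psi>(m)\<close> for a monomial \<open>m\<close>; see \<open>psi_mon\<close>.\<close>

definition psi_expo :: "('n::finite \<Rightarrow> nat) \<Rightarrow> 'n expo \<Rightarrow> 'n expo" where
  "psi_expo w u = (\<Sum>i\<in>UNIV. Poly_Mapping.single i (w i * Poly_Mapping.lookup u i))"

abbreviation ideal_gen :: "('n, 'k::comm_ring_1) mpoly set \<Rightarrow> ('n, 'k) mpoly set" where
  "ideal_gen B \<equiv> genideal class_ring B"

definition monomial_ideal :: "('n, 'k::comm_ring_1) mpoly set \<Rightarrow> bool" where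
  "monomial_ideal J \<longleftrightarrow> (\<exists>M. J = ideal_gen (mon ` M))"

text \<open>The list \<open>ps\<close> collects the pairs \<open>(i\<^sub>t, j\<^sub>t)\<close>, and \<open>q\<close> is the cofactor of
  \<open>y\<^bsub>j\<^sub>1\<^esub> \<cdots> y\<^bsub>j\<^sub>s\<^esub>\<close> in the monomial \<open>u\<close>.\<close>

definition borel_move :: "'n::linorder expo \<Rightarrow> 'n expo \<Rightarrow> bool" where
  "borel_move u v \<longleftrightarrow> (\<exists>ps q. (\<forall>(i, j)\<in>set ps. i < j) \<and>
     u = q + (\<Sum>(i, j)\<leftarrow>ps. Poly_Mapping.single j 1) \<and>
     v = q + (\<Sum>(i, j)\<leftarrow>ps. Poly_Mapping.single i 1))"

definition strongly_stable :: "('n::linorder, 'k::comm_ring_1) mpoly set \<Rightarrow> bool" where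
  "strongly_stable J \<longleftrightarrow> monomial_ideal J \<and>
     (\<forall>u v. mon u \<in> J \<longrightarrow> borel_move u v \<longrightarrow> mon v \<in> J)"

definition Borel :: "('n::linorder, 'k::comm_ring_1) mpoly \<Rightarrow> ('n, 'k) mpoly set" where
  "Borel \<mu> = \<Inter> {J. strongly_stable J \<and> \<mu> \<in> J}"

definition principal_stable ::
    "('n::{finite,linorder} \<Rightarrow> nat) \<Rightarrow> ('n, 'k::comm_ring_1) mpoly \<Rightarrow> ('n, 'k) mpoly set" where
  "principal_stable w m = psi w -` Borel (psi w m)"

definition index_list :: "'n::{finite,linorder} expo \<Rightarrow> 'n list" where
  "index_list u = concat (map (\<lambda>i. replicate (Poly_Mapping.lookup u i) i) (sorted_list_of_set UNIV))"

definition trunc :: "nat \<Rightarrow> 'n::{finite,linorder} expo \<Rightarrow> 'n expo" where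
  "trunc e u = (\<Sum>i\<leftarrow>take e (index_list u). Poly_Mapping.single i 1)"

definition trunc_ideal ::
    "nat \<Rightarrow> ('n::{finite,linorder}, 'k::comm_ring_1) mpoly set \<Rightarrow> ('n, 'k) mpoly set" where
  "trunc_ideal e J = ideal_gen {mon (trunc e u) | u. mon u \<in> J}"

definition max_index :: "'n::linorder expo \<Rightarrow> 'n" where
  "max_index u = Max (Poly_Mapping.keys u)"

text \<open>The smallest set of monomials generating a monomial ideal; it is again a generating set and
  consists of the divisibility-minimal monomials of the ideal (\<open>monomial_ideal_min_gens\<close> and
  \<open>min_gens_iff\<close> below).\<close>

definition min_gens :: "('n, 'k::comm_ring_1) mpoly set \<Rightarrow> 'n expo set" where
  "min_gens J = \<Inter> {M. J = ideal_gen (mon ` M)}"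

definition homogeneous ::
    "('n::finite \<Rightarrow> nat) \<Rightarrow> nat \<Rightarrow> ('n, 'k::comm_ring_1) mpoly set" where
  "homogeneous w i = {f. \<forall>u\<in>Poly_Mapping.keys f. wdeg w u = i}"

text \<open>The \<open>\<bbbK>\<close>-vector space \<open>(S/I)\<^sub>i\<close>: the image of the degree \<open>i\<close> forms in the quotient ring, on
  which \<open>a \<in> \<bbbK>\<close> acts as multiplication by its residue class.\<close>

definition quot_comp :: "('n::finite \<Rightarrow> nat) \<Rightarrow> ('n, 'k::field) mpoly set \<Rightarrow> nat
    \<Rightarrow> ('k, ('n, 'k) mpoly set) module" where
  "quot_comp w I i =
     (let Q = FactRing class_ring I; residue = a_r_coset class_ring I in
      \<lparr>carrier = residue ` homogeneous w i, mult = mult Q, one = one Q, zero = zero Q, add = add Q,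
       smult = (\<lambda>a C. mult Q (residue (cst a)) C)\<rparr>)"

definition hilbert_series :: "('n::finite \<Rightarrow> nat) \<Rightarrow> ('n, 'k::field) mpoly set \<Rightarrow> rat fps" where
  "hilbert_series w I =
     Abs_fps (\<lambda>i. of_nat (vectorspace.dim (class_ring :: 'k ring) (quot_comp w I i)))"

lemma mon_add: "mon (u + v) = mon u * mon v"
  by (simp add: mon_def Poly_Mapping.mult_single)

lemma mon_zero: "mon 0 = 1"
  by (simp add: mon_def)

lemma mon_sum: "mon (\<Sum>i\<in>A. f i) = (\<Prod>i\<in>A. mon (f i))"
  by (induction A rule: infinite_finite_induct) (auto simp: mon_add mon_zero)

lemma mon_pow_var: "var i ^ k = mon (Poly_Mapping.single i k)"
  by (induction k) (auto simp: mon_zero var_def mon_add[symmetric] Poly_Mapping.single_add[symmetric])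

lemma psi_expo_eq:
  "mon (psi_expo w u) = (\<Prod>i\<in>UNIV. (var i ^ w i) ^ Poly_Mapping.lookup u i)"
  unfolding psi_expo_def mon_sum by (intro prod.cong refl) (simp only: mon_pow_var[symmetric] power_mult)

lemma psi_alt: "psi w f = (\<Sum>u\<in>Poly_Mapping.keys f. cst (Poly_Mapping.lookup f u) * mon (psi_expo w u))"
  by (simp add: psi_def psi_expo_eq)

lemma psi_superset:
  assumes "finite A" "Poly_Mapping.keys f \<subseteq> A"
  shows "psi w f = (\<Sum>u\<in>A. cst (Poly_Mapping.lookup f u) * mon (psi_expo w u))"
  unfolding psi_alt using assms
  by (intro sum.mono_neutral_left) (auto simp: cst_def in_keys_iff)

lemma psi_add: "psi w (f + g) = psi w f + psi w g"
proof -
  let ?A = "Poly_Mapping.keys f \<union> Poly_Mapping.keys g"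
  have "psi w (f + g) = (\<Sum>u\<in>?A. cst (Poly_Mapping.lookup (f + g) u) * mon (psi_expo w u))"
    by (rule psi_superset) (use Poly_Mapping.keys_add[of f g] in auto)
  also have "\<dots> = (\<Sum>u\<in>?A. cst (Poly_Mapping.lookup f u) * mon (psi_expo w u)) +
      (\<Sum>u\<in>?A. cst (Poly_Mapping.lookup g u) * mon (psi_expo w u))"
    by (simp add: lookup_add cst_def Poly_Mapping.single_add distrib_right sum.distrib)
  also have "\<dots> = psi w f + psi w g"
    by (subst (1 2) psi_superset[where A = ?A]) auto
  finally show ?thesis .
qed

lemma psi_single: "psi w (Poly_Mapping.single u a) = cst a * mon (psi_expo w u)"
  by (cases "a = 0") (auto simp: psi_alt cst_def)

lemma psi_mon: "psi w (mon u) = mon (psi_expo w u)"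
  by (simp add: mon_def psi_single) (simp add: cst_def mon_def)

lemma lookup_psi_expo: "Poly_Mapping.lookup (psi_expo w u) i = w i * Poly_Mapping.lookup u i"
  by (simp add: psi_expo_def lookup_sum lookup_single when_def)

lemma psi_expo_add: "psi_expo w (u + v) = psi_expo w u + psi_expo w v"
  by (rule poly_mapping_eqI) (simp add: lookup_psi_expo lookup_add distrib_left)

lemma sum_single:
  fixes f :: "('n, 'k::comm_ring_1) mpoly"
  shows "(\<Sum>u\<in>Poly_Mapping.keys f. Poly_Mapping.single u (Poly_Mapping.lookup f u)) = f"
  by (rule poly_mapping_eqI)
    (auto simp: lookup_sum lookup_single when_def in_keys_iff sum.delta)

lemma mpoly_induct [case_names single add]:
  fixes f :: "('n, 'k::comm_ring_1) mpoly"
  assumes "\<And>u a. P (Poly_Mapping.single u a)" "\<And>f g. P f \<Longrightarrow> P g \<Longrightarrow> P (f + g)"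
  shows "P f"
proof -
  have "P (\<Sum>u\<in>A. Poly_Mapping.single u (Poly_Mapping.lookup f u))" if "finite A" for A
    using that
  proof induction
    case empty
    show ?case using assms(1)[of _ 0] by simp
  qed (simp add: assms)
  from this[of "Poly_Mapping.keys f"] show ?thesis
    by (simp add: sum_single)
qed

lemma psi_mult: "psi w (f * g) = psi w f * psi w g"
proof (induction f rule: mpoly_induct)
  case (single u a)
  show ?case
    by (induction g rule: mpoly_induct)
      (simp_all add: Poly_Mapping.mult_single psi_single psi_expo_add cst_def mon_def distrib_left psi_add)
qed (simp add: distrib_right psi_add)

lemma psi_cst: "psi w (cst a) = cst a"
proof -
  have "psi_expo w 0 = 0"
    by (rule poly_mapping_eqI) (simp add: lookup_psi_expo)
  then show ?thesis
    by (simp add: cst_def psi_single mon_zero)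
qed

lemma psi_var: "psi w (var i) = var i ^ w i"
proof -
  have "psi_expo w (Poly_Mapping.single i 1) = Poly_Mapping.single i (w i)"
    by (rule poly_mapping_eqI) (auto simp: lookup_psi_expo lookup_single when_def)
  then show ?thesis
    by (simp only: mon_pow_var) (simp only: var_def psi_mon)
qed

lemma mon_inject: "(mon u :: ('n, 'k::comm_ring_1) mpoly) = mon v \<longleftrightarrow> u = v"
proof
  assume "(mon u :: ('n, 'k) mpoly) = mon v"
  then have "Poly_Mapping.keys (mon u :: ('n, 'k) mpoly) = Poly_Mapping.keys (mon v :: ('n, 'k) mpoly)"
    by (rule arg_cong)
  then show "u = v" by (simp add: mon_def)
qed (rule arg_cong)

lemma class_ring_ideal_iff:
  "ideal I (class_ring :: 'a::comm_ring_1 ring) \<longleftrightarrow>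
     0 \<in> I \<and> (\<forall>x\<in>I. \<forall>y\<in>I. x + y \<in> I) \<and> (\<forall>x\<in>I. \<forall>r. r * x \<in> I)" (is "?L \<longleftrightarrow> ?R")
proof
  assume ?L
  then interpret ideal I "class_ring :: 'a ring" .
  show ?R
    using zero_closed a_closed I_l_closed by auto
next
  assume R: ?R
  show ?L
  proof (rule idealI[OF class_ring.ring_axioms])
    have "a_inv (class_ring :: 'a ring) x = - x" for x
      by (simp only: class_ring_simps)
    then have "inv\<^bsub>add_monoid (class_ring :: 'a ring)\<^esub> x = - x" for x
      by (simp add: a_inv_def)
    moreover have "- x \<in> I" if "x \<in> I" for x
      using R that by (metis mult_minus1)
    ultimately show "subgroup I (add_monoid (class_ring :: 'a ring))"
      using R by unfold_locales auto
  qed (use R in \<open>auto simp: mult.commute\<close>)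
qed

lemma ideal_sum_mem:
  assumes "ideal I (class_ring :: 'a::comm_ring_1 ring)" "\<And>a. a \<in> A \<Longrightarrow> f a \<in> I"
  shows "sum f A \<in> I"
  using assms by (induction A rule: infinite_finite_induct) (auto simp: class_ring_ideal_iff)

lemma in_ideal_gen_mon_iff:
  "f \<in> ideal_gen (mon ` M) \<longleftrightarrow> (\<forall>u\<in>Poly_Mapping.keys f. \<exists>v\<in>M. \<exists>q. u = q + v)"
    (is "_ \<longleftrightarrow> ?D f")
proof
  have "ideal {f :: ('a, 'b) mpoly. ?D f} class_ring"
    unfolding class_ring_ideal_iff
  proof (intro conjI ballI allI)
    fix x y :: "('a, 'b) mpoly" assume "x \<in> {f. ?D f}" "y \<in> {f. ?D f}"
    then show "x + y \<in> {f. ?D f}" using Poly_Mapping.keys_add[of x y] by blast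
  next
    fix x r :: "('a, 'b) mpoly" assume x: "x \<in> {f. ?D f}"
    show "r * x \<in> {f. ?D f}"
    proof (rule CollectI, rule ballI)
      fix u assume "u \<in> Poly_Mapping.keys (r * x)"
      then obtain a b where ab: "u = a + b" "b \<in> Poly_Mapping.keys x"
        using subsetD[OF Poly_Mapping.keys_mult] by blast
      then obtain v q where "v \<in> M" "b = q + v"
        using bspec[OF CollectD[OF x]] by blast
      then show "\<exists>v\<in>M. \<exists>q. u = q + v"
        using ab(1) by (intro bexI[of _ v] exI[of _ "a + q"]) (simp_all add: add.assoc)
    qed
  qed simp
  moreover have "mon ` M \<subseteq> {f :: ('a, 'b) mpoly. ?D f}"
  proof clarify
    fix u v assume "v \<in> M" "u \<in> Poly_Mapping.keys (mon v :: ('a, 'b) mpoly)"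
    then have "v \<in> M" "u = 0 + v" by (auto simp: mon_def)
    then show "\<exists>v\<in>M. \<exists>q. u = q + v" by blast
  qed
  ultimately have "ideal_gen (mon ` M) \<subseteq> {f :: ('a, 'b) mpoly. ?D f}"
    by (rule ring.genideal_minimal[OF class_ring.ring_axioms])
  then show "f \<in> ideal_gen (mon ` M) \<Longrightarrow> ?D f" by blast
next
  assume D: "?D f"
  have ideal: "ideal (ideal_gen (mon ` M) :: ('a, 'b) mpoly set) class_ring"
    by (rule ring.genideal_ideal[OF class_ring.ring_axioms]) simp
  have "Poly_Mapping.single u (Poly_Mapping.lookup f u) \<in> ideal_gen (mon ` M)"
    if "u \<in> Poly_Mapping.keys f" for u
  proof -
    obtain v q where v: "v \<in> M" "u = q + v" using D \<open>u \<in> Poly_Mapping.keys f\<close> by blast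
    have "mon v \<in> (ideal_gen (mon ` M) :: ('a, 'b) mpoly set)"
      using ring.genideal_self[OF class_ring.ring_axioms, of "mon ` M :: ('a, 'b) mpoly set"] v(1) by auto
    moreover have "Poly_Mapping.single u (Poly_Mapping.lookup f u) =
        Poly_Mapping.single q (Poly_Mapping.lookup f u) * mon v"
      by (simp add: mon_def Poly_Mapping.mult_single v(2))
    ultimately show ?thesis
      using ideal by (simp add: class_ring_ideal_iff)
  qed
  then have "(\<Sum>u\<in>Poly_Mapping.keys f. Poly_Mapping.single u (Poly_Mapping.lookup f u)) \<in> ideal_gen (mon ` M)"
    by (rule ideal_sum_mem[OF ideal])
  then show "f \<in> ideal_gen (mon ` M)"
    by (simp only: sum_single)
qed

lemma mon_in_ideal_gen_iff:
  "(mon u :: ('n, 'k::comm_ring_1) mpoly) \<in> ideal_gen (mon ` M) \<longleftrightarrow> (\<exists>v\<in>M. \<exists>q. u = q + v)"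
  unfolding in_ideal_gen_mon_iff by (simp add: mon_def)

lemma monomial_idealI:
  assumes "ideal J (class_ring :: ('n, 'k::comm_ring_1) mpoly ring)"
    "\<And>f u. f \<in> J \<Longrightarrow> u \<in> Poly_Mapping.keys f \<Longrightarrow> mon u \<in> J"
  shows "monomial_ideal J"
proof -
  have "J = ideal_gen (mon ` {u. mon u \<in> J})"
  proof
    show "ideal_gen (mon ` {u. mon u \<in> J}) \<subseteq> J"
      by (rule ring.genideal_minimal[OF class_ring.ring_axioms]) (use assms(1) in auto)
    show "J \<subseteq> ideal_gen (mon ` {u. mon u \<in> J})"
    proof
      fix f assume "f \<in> J"
      then show "f \<in> ideal_gen (mon ` {u. mon u \<in> J})"
        unfolding in_ideal_gen_mon_iff using assms(2) by (metis add_0 mem_Collect_eq)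
    qed
  qed
  then show ?thesis unfolding monomial_ideal_def by blast
qed

lemma monomial_idealD:
  assumes "monomial_ideal (J :: ('n, 'k::comm_ring_1) mpoly set)"
  shows "ideal J class_ring" "f \<in> J \<Longrightarrow> u \<in> Poly_Mapping.keys f \<Longrightarrow> mon u \<in> J"
proof -
  obtain M where J: "J = ideal_gen (mon ` M)" using assms by (auto simp: monomial_ideal_def)
  show "ideal J class_ring" unfolding J by (rule ring.genideal_ideal[OF class_ring.ring_axioms]) simp
  show "f \<in> J \<Longrightarrow> u \<in> Poly_Mapping.keys f \<Longrightarrow> mon u \<in> J"
    unfolding J mon_in_ideal_gen_iff by (simp add: in_ideal_gen_mon_iff)
qed

lemma strongly_stable_Borel: "strongly_stable (Borel \<mu>)"
  unfolding strongly_stable_def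
proof (intro conjI allI impI)
  let ?F = "{J. strongly_stable J \<and> \<mu> \<in> J}"
  have mi: "monomial_ideal J" if "J \<in> ?F" for J
    using that by (simp add: strongly_stable_def)
  show "monomial_ideal (Borel \<mu>)"
  proof (rule monomial_idealI)
    show "ideal (Borel \<mu>) class_ring"
      using monomial_idealD(1)[OF mi] unfolding Borel_def class_ring_ideal_iff by blast
    show "mon u \<in> Borel \<mu>" if "f \<in> Borel \<mu>" "u \<in> Poly_Mapping.keys f" for f u
      using monomial_idealD(2)[OF mi] that unfolding Borel_def by blast
  qed
next
  show "mon v \<in> Borel \<mu>" if "mon u \<in> Borel \<mu>" "borel_move u v" for u v
    using that unfolding Borel_def strongly_stable_def by blast
qed

lemma in_Borel_self: "\<mu> \<in> Borel \<mu>"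
  by (simp add: Borel_def)

lemma wdeg_add: "wdeg w (u + v) = wdeg w u + wdeg w v"
  by (simp add: wdeg_def lookup_add distrib_left sum.distrib)

lemma tdeg_eq_0_iff: "tdeg u = 0 \<longleftrightarrow> u = 0"
  by (simp add: wdeg_def poly_mapping_eq_iff fun_eq_iff)

lemma
  assumes "monomial_ideal (J :: ('n::finite, 'k::comm_ring_1) mpoly set)"
  shows min_gens_iff: "u \<in> min_gens J \<longleftrightarrow> mon u \<in> J \<and> (\<forall>v q. mon v \<in> J \<longrightarrow> u = q + v \<longrightarrow> q = 0)"
    and monomial_ideal_min_gens: "J = ideal_gen (mon ` min_gens J)"
proof -
  define N where "N = {u. mon u \<in> J \<and> (\<forall>v q. mon v \<in> J \<longrightarrow> u = q + v \<longrightarrow> q = 0)}"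
  note ideal = monomial_idealD(1)[OF assms]
  have dvd: "\<exists>v\<in>N. \<exists>q. u = q + v" if "mon u \<in> J" for u
    using that
  proof (induction "tdeg u" arbitrary: u rule: less_induct)
    case less
    show ?case
    proof (cases "u \<in> N")
      case True
      then show ?thesis by (metis add_0)
    next
      case False
      then obtain v q where vq: "mon v \<in> J" "u = q + v" "q \<noteq> 0"
        using less.prems by (auto simp: N_def)
      then have "tdeg v < tdeg u"
        using tdeg_eq_0_iff[of q] by (simp add: wdeg_add)
      from less.hyps[OF this vq(1)] show ?thesis
        unfolding vq(2) by (metis add.assoc)
    qed
  qed
  have gen: "J = ideal_gen (mon ` N)"
  proof
    show "ideal_gen (mon ` N) \<subseteq> J"
      by (rule ring.genideal_minimal[OF class_ring.ring_axioms]) (use ideal in \<open>auto simp: N_def\<close>)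
    show "J \<subseteq> ideal_gen (mon ` N)"
      using dvd monomial_idealD(2)[OF assms] by (auto simp: in_ideal_gen_mon_iff)
  qed
  have "N \<subseteq> M" if M: "J = ideal_gen (mon ` M)" for M
  proof
    fix u assume u: "u \<in> N"
    then have "mon u \<in> J" by (simp add: N_def)
    then obtain v q where v: "v \<in> M" "u = q + v"
      unfolding M mon_in_ideal_gen_iff by blast
    have "mon v \<in> J"
      unfolding M mon_in_ideal_gen_iff using v(1) by (metis add_0)
    with u v have "q = 0" by (simp add: N_def)
    with v show "u \<in> M" by simp
  qed
  then have mg: "min_gens J = N"
    unfolding min_gens_def using gen by blast
  show "u \<in> min_gens J \<longleftrightarrow> mon u \<in> J \<and> (\<forall>v q. mon v \<in> J \<longrightarrow> u = q + v \<longrightarrow> q = 0)"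
    "J = ideal_gen (mon ` min_gens J)"
    by (simp only: mg N_def mem_Collect_eq, simp only: mg gen[symmetric])
qed

lemma psi_zero: "psi w 0 = 0"
  by (simp add: psi_def)

lemma ideal_principal_stable: "ideal (principal_stable w m) class_ring"
proof -
  have "ideal (Borel (psi w m)) class_ring"
    using strongly_stable_Borel[of "psi w m"] monomial_idealD(1) by (auto simp: strongly_stable_def)
  then show ?thesis
    by (auto simp: class_ring_ideal_iff principal_stable_def psi_zero psi_add psi_mult)
qed

lemma vectorspace_quot_comp:
  fixes I :: "('n::finite, 'k::field) mpoly set"
  assumes "ideal I class_ring"
  shows "vectorspace class_ring (quot_comp w I i)"
proof -
  interpret I: ideal I "class_ring :: ('n, 'k) mpoly ring" by fact
  interpret Q: ring "FactRing class_ring I" by (rule I.quotient_is_ring)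
  let ?r = "a_r_coset class_ring I"
  have add: "add (FactRing class_ring I) (?r f) (?r g) = ?r (f + g)" for f g
    using I.a_rcos_sum[of f g] by (simp add: FactRing_def)
  have mult: "mult (FactRing class_ring I) (?r f) (?r g) = ?r (f * g)" for f g
    using I.rcoset_mult_add[of f g] by (simp add: FactRing_def)
  have zero: "zero (FactRing class_ring I) = ?r 0"
    using I.a_rcos_sum[of 0 0] by (auto simp: FactRing_def a_r_coset_def r_coset_def)
  have h0: "0 \<in> homogeneous w i" by (simp add: homogeneous_def)
  have hadd: "f + g \<in> homogeneous w i" if "f \<in> homogeneous w i" "g \<in> homogeneous w i" for f g :: "('n, 'k) mpoly"
    using that Poly_Mapping.keys_add[of f g] unfolding homogeneous_def by blast
  have hmult: "cst a * f \<in> homogeneous w i" if "f \<in> homogeneous w i" for a and f :: "('n, 'k) mpoly"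
    using that Poly_Mapping.keys_mult[of "cst a" f]
    by (fastforce simp: homogeneous_def cst_def split: if_splits)
  have cst: "cst (a + b) = cst a + cst b" "cst (a * b) = cst a * cst b" "cst 1 = (1 :: ('n, 'k) mpoly)"
    for a b :: 'k
    by (simp_all add: cst_def Poly_Mapping.single_add Poly_Mapping.mult_single)
  have inv: "\<exists>g\<in>homogeneous w i. ?r (g + f) = ?r 0" if "f \<in> homogeneous w i" for f :: "('n, 'k) mpoly"
    using hmult[OF that, of "-1"] by (intro bexI[of _ "- f"]) (simp_all add: cst_def Poly_Mapping.single_uminus)
  let ?V = "quot_comp w I i"
  have car: "carrier ?V = ?r ` homogeneous w i"
    and addV: "?r f \<oplus>\<^bsub>?V\<^esub> ?r g = ?r (f + g)"
    and zeroV: "\<zero>\<^bsub>?V\<^esub> = ?r 0"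
    and smultV: "a \<odot>\<^bsub>?V\<^esub> ?r f = ?r (cst a * f)" for f g a
    by (simp_all only: quot_comp_def Let_def partial_object.simps monoid.simps ring.simps module.simps
        add mult zero)
  have "abelian_group ?V"
  proof (rule abelian_groupI, unfold car zeroV)
    fix x y assume "x \<in> ?r ` homogeneous w i" "y \<in> ?r ` homogeneous w i"
    then show "x \<oplus>\<^bsub>?V\<^esub> y \<in> ?r ` homogeneous w i" "x \<oplus>\<^bsub>?V\<^esub> y = y \<oplus>\<^bsub>?V\<^esub> x"
      using hadd by (auto simp only: addV add.commute intro: imageI)
  next
    fix x y z assume "x \<in> ?r ` homogeneous w i" "y \<in> ?r ` homogeneous w i" "z \<in> ?r ` homogeneous w i"
    then show "x \<oplus>\<^bsub>?V\<^esub> y \<oplus>\<^bsub>?V\<^esub> z = x \<oplus>\<^bsub>?V\<^esub> (y \<oplus>\<^bsub>?V\<^esub> z)"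
      by (auto simp only: addV add.assoc)
  next
    fix x assume "x \<in> ?r ` homogeneous w i"
    then show "?r 0 \<oplus>\<^bsub>?V\<^esub> x = x" "\<exists>y\<in>?r ` homogeneous w i. y \<oplus>\<^bsub>?V\<^esub> x = ?r 0"
      using inv by (auto simp only: addV add_0 bex_simps)
  qed (rule imageI, rule h0)
  then have "module (class_ring :: 'k ring) ?V"
  proof (rule moduleI[OF class_cring.cring_axioms], unfold car)
    fix a b x y assume "x \<in> ?r ` homogeneous w i" "y \<in> ?r ` homogeneous w i"
    then obtain f g where fg: "x = ?r f" "y = ?r g" "f \<in> homogeneous w i" "g \<in> homogeneous w i"
      by blast
    show "a \<odot>\<^bsub>?V\<^esub> (x \<oplus>\<^bsub>?V\<^esub> y) = a \<odot>\<^bsub>?V\<^esub> x \<oplus>\<^bsub>?V\<^esub> a \<odot>\<^bsub>?V\<^esub> y"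
      by (simp only: fg addV smultV distrib_left)
  next
    fix a b x assume "x \<in> ?r ` homogeneous w i"
    then obtain f where f: "x = ?r f" "f \<in> homogeneous w i"
      by blast
    show "a \<odot>\<^bsub>?V\<^esub> x \<in> ?r ` homogeneous w i"
      using hmult f(2) by (simp only: f(1) smultV imageI)
    show "(a \<oplus>\<^bsub>class_ring\<^esub> b) \<odot>\<^bsub>?V\<^esub> x = a \<odot>\<^bsub>?V\<^esub> x \<oplus>\<^bsub>?V\<^esub> b \<odot>\<^bsub>?V\<^esub> x"
      "(a \<otimes>\<^bsub>class_ring\<^esub> b) \<odot>\<^bsub>?V\<^esub> x = a \<odot>\<^bsub>?V\<^esub> (b \<odot>\<^bsub>?V\<^esub> x)"
      by (simp_all only: f(1) addV smultV cst distrib_right mult.assoc ring.simps monoid.simps)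
    show "\<one>\<^bsub>class_ring :: 'k ring\<^esub> \<odot>\<^bsub>?V\<^esub> x = x"
      by (simp only: f(1) smultV cst mult_1 monoid.simps)
  qed
  then show ?thesis
    by (simp add: vectorspace_def class_field.field_axioms)
qed

end

theory Submission
  imports Defs
begin

text \<open>
  A monomial lies in \<open>Borel(\<mu>)\<close> iff for every \<open>j\<close> its degree in the variables up to \<open>j\<close> is at
  least that of \<open>\<mu>\<close>, and truncation cuts these partial degrees off at \<open>s\<close>; so both the Borel ideal
  and \<open>G\<^sub>s\<close> are described by partial degrees.  If \<open>v \<notin> Borel(\<mu>)\<close>, let \<open>j\<close> be the first index at which
  the inequality fails and \<open>s\<close> the partial degree of \<open>v\<close> there.  Then \<open>j = k\<^sub>s\<close>, the part of \<open>v\<close> in the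
  variables up to \<open>k\<^sub>s\<close> lies in \<open>G\<^sub>s\<close>, and the part in the remaining variables is arbitrary.  This
  splits the monomials outside the ideal into \<open>d\<close> disjoint classes.  Since \<open>\<psi>\<close> respects the splitting
  by variables, pulling it back gives a basis of \<open>S/I\<close>, and each class contributes one summand.
\<close>

section \<open>Partial degrees and the dominance order\<close>

definition psum :: "'n::{finite,linorder} \<Rightarrow> 'n expo \<Rightarrow> nat" where
  "psum j u = (\<Sum>i\<in>{..j}. Poly_Mapping.lookup u i)"

text \<open>The dominance order, with the larger vector as first argument. The degrees may differ;
  the last index compares them.\<close>

definition dominates :: "'n::{finite,linorder} expo \<Rightarrow> 'n expo \<Rightarrow> bool" where
  "dominates v u \<longleftrightarrow> (\<forall>j. psum j u \<le> psum j v)"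

definition restrict_expo :: "'n::finite set \<Rightarrow> 'n expo \<Rightarrow> 'n expo" where
  "restrict_expo A u = (\<Sum>i\<in>A. Poly_Mapping.single i (Poly_Mapping.lookup u i))"

lemma psum_zero [simp]: "psum j 0 = 0"
  by (simp add: psum_def)

lemma psum_add [simp]: "psum j (u + v) = psum j u + psum j v"
  by (simp add: psum_def lookup_add sum.distrib)

lemma psum_single [simp]: "psum j (Poly_Mapping.single i a) = (if i \<le> j then a else 0)"
  by (simp add: psum_def lookup_single when_def)

lemma psum_mono: "i \<le> j \<Longrightarrow> psum i u \<le> psum j u"
  unfolding psum_def by (intro sum_mono2) auto

lemma tdeg_eq_psum: "(\<And>i. Poly_Mapping.lookup u i \<noteq> 0 \<Longrightarrow> i \<le> j) \<Longrightarrow> tdeg u = psum j u"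
  unfolding psum_def wdeg_def by (intro sum.mono_neutral_cong_right) auto

lemma tdeg_eq_psum_Max: "tdeg u = psum (Max UNIV) u"
  by (rule tdeg_eq_psum) simp

lemma psum_le_tdeg: "psum j u \<le> tdeg u"
  unfolding tdeg_eq_psum_Max by (intro psum_mono) simp

lemma psum_eq_tdegD:
  assumes "psum j u = tdeg u" "j < i"
  shows "Poly_Mapping.lookup u i = 0"
proof -
  have "psum j u + Poly_Mapping.lookup u i = (\<Sum>l\<in>insert i {..j}. Poly_Mapping.lookup u l)"
    using assms(2) by (simp add: psum_def)
  also have "\<dots> \<le> tdeg u"
    unfolding wdeg_def by (simp only: mult_1) (intro sum_mono2, auto)
  finally show ?thesis using assms(1) by simp
qed

lemma dominates_add: "dominates v u \<Longrightarrow> dominates (q + v) u"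
  by (simp add: dominates_def trans_le_add2)

section \<open>Borel ideals through domination\<close>

text \<open>Replacing \<open>y_j\<close> by \<open>y_i\<close> with \<open>i < j\<close> raises the
  partial degrees at the indices from \<open>i\<close> up to but excluding \<open>j\<close> by one
  and leaves the others alone.\<close>

lemma borel_move_dominates:
  assumes "borel_move u v"
  shows "dominates v u"
proof -
  obtain ps q where ps: "\<forall>(i, j)\<in>set ps. i < j"
    and u: "u = q + (\<Sum>(i, j)\<leftarrow>ps. Poly_Mapping.single j 1)"
    and v: "v = q + (\<Sum>(i, j)\<leftarrow>ps. Poly_Mapping.single i 1)"
    using assms by (auto simp: borel_move_def)
  have "psum l (\<Sum>(i, j)\<leftarrow>ps. Poly_Mapping.single j 1) \<le> psum l (\<Sum>(i, j)\<leftarrow>ps. Poly_Mapping.single i 1)" for l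
    using ps by (induction ps) (auto split: if_splits intro: add_mono)
  then show ?thesis by (simp add: dominates_def u v)
qed

lemma borel_move_single:
  assumes "j < i" "Poly_Mapping.lookup u i > 0"
  obtains q where "u = q + Poly_Mapping.single i 1" "borel_move u (q + Poly_Mapping.single j 1)"
proof
  let ?q = "u - Poly_Mapping.single i 1"
  show u: "u = ?q + Poly_Mapping.single i 1"
    using assms(2) by (intro poly_mapping_eqI) (auto simp: lookup_add lookup_minus lookup_single when_def)
  show "borel_move u (?q + Poly_Mapping.single j 1)"
    unfolding borel_move_def using assms(1) u
    by (intro exI[of _ "[(j, i)]"] exI[of _ ?q]) simp
qed

lemma finite_linorder_least:
  fixes P :: "'a::{finite,linorder} \<Rightarrow> bool"
  assumes "\<exists>i. P i"
  shows "\<exists>j. P j \<and> (\<forall>l<j. \<not> P l)"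
proof (intro exI conjI allI impI)
  show "P (Min {j. P j})"
    using Min_in[of "{j. P j}"] assms by auto
  show "\<not> P l" if "l < Min {j. P j}" for l
    using that Min_le[of "{j. P j}" l] by (simp flip: not_less) blast
qed

text \<open>As long as \<open>u\<close> does not divide \<open>v\<close>, a single move pushes
  \<open>u\<close> towards \<open>v\<close> and keeps it dominated. Each move shrinks the total gap
  between the partial degrees, which is the induction measure.\<close>

lemma strongly_stable_dominates:
  fixes J :: "('n::{finite,linorder}, 'k::comm_ring_1) mpoly set"
  assumes J: "strongly_stable J" and "mon u \<in> J" "dominates v u"
  shows "mon v \<in> J"
  using assms(2,3)
proof (induction "\<Sum>j\<in>UNIV. psum j v - psum j u" arbitrary: u rule: less_induct)
  case less
  have ideal: "ideal J class_ring"
    using J monomial_idealD(1) by (auto simp: strongly_stable_def)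
  show ?case
  proof (cases "\<forall>i. Poly_Mapping.lookup u i \<le> Poly_Mapping.lookup v i")
    case True
    then have "v = (v - u) + u"
      by (intro poly_mapping_eqI) (simp add: lookup_add lookup_minus)
    then have "(mon v :: ('n, 'k) mpoly) = mon (v - u) * mon u" by (metis mon_add)
    then show ?thesis using ideal less.prems(1) unfolding class_ring_ideal_iff by metis
  next
    case False
    then have "\<exists>i. Poly_Mapping.lookup u i > Poly_Mapping.lookup v i" by (auto simp: not_le)
    then obtain i where i: "Poly_Mapping.lookup u i > Poly_Mapping.lookup v i"
      and least: "\<And>l. l < i \<Longrightarrow> \<not> Poly_Mapping.lookup u l > Poly_Mapping.lookup v l"
      using finite_linorder_least[of "\<lambda>i. Poly_Mapping.lookup u i > Poly_Mapping.lookup v i"] by blast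
    \<comment> \<open>Without such a \<open>j\<close>, \<open>v\<close> would be at most
      \<open>u\<close> everywhere up to \<open>i\<close> and smaller at \<open>i\<close>, against
      domination at \<open>i\<close>.\<close>
    have "\<exists>j<i. Poly_Mapping.lookup u j < Poly_Mapping.lookup v j"
    proof (rule ccontr)
      assume neg: "\<not> ?thesis"
      then have "Poly_Mapping.lookup v l \<le> Poly_Mapping.lookup u l" if "l \<le> i" for l
        using that i neg by (metis le_less not_less)
      then have "psum i v < psum i u"
        unfolding psum_def using i by (intro sum_strict_mono_ex1) auto
      then show False using less.prems(2) leD by (auto simp: dominates_def)
    qed
    then obtain j where j: "j < i" "Poly_Mapping.lookup u j < Poly_Mapping.lookup v j" by blast
    obtain q where q: "u = q + Poly_Mapping.single i 1" "borel_move u (q + Poly_Mapping.single j 1)"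
      using borel_move_single[of j i u] j(1) i by auto
    let ?u = "q + Poly_Mapping.single j 1"
    \<comment> \<open>Before \<open>i\<close> no exponent of \<open>u\<close> exceeds that of
      \<open>v\<close>, and at \<open>j\<close> it is smaller. This leaves room for the unit that
      the move adds to exactly these partial degrees.\<close>
    have strict: "psum l u < psum l v" if "j \<le> l" "l < i" for l
      unfolding psum_def using that j least by (intro sum_strict_mono_ex1) (auto simp: not_less)
    have psum_q: "psum l ?u = (if j \<le> l \<and> l < i then Suc (psum l u) else psum l u)" for l
      using j(1) by (auto simp: q(1))
    have "dominates v ?u"
      using less.prems(2) strict unfolding dominates_def psum_q by (auto simp: Suc_le_eq)
    moreover have "(\<Sum>l\<in>UNIV. psum l v - psum l ?u) < (\<Sum>l\<in>UNIV. psum l v - psum l u)"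
      unfolding psum_q using strict j(1)
      by (intro sum_strict_mono_ex1) (auto intro!: bexI[of _ j] diff_less_mono2)
    moreover have "mon ?u \<in> J"
      using J less.prems(1) q(2) by (auto simp: strongly_stable_def)
    ultimately show ?thesis using less.hyps by blast
  qed
qed

text \<open>The support of a product lies in the sum of the supports, so closure need only be tested
  on monomials. \<open>Borel_mon\<close> applies this to the vectors dominating
  \<open>u\<close>.\<close>

lemma ideal_support_iff:
  "ideal {f :: ('n, 'k::comm_ring_1) mpoly. Poly_Mapping.keys f \<subseteq> M} class_ring \<longleftrightarrow> (\<forall>u\<in>M. \<forall>q. q + u \<in> M)"
    (is "?L \<longleftrightarrow> ?R")
proof
  assume ?L
  then have mult: "Poly_Mapping.keys (r * x) \<subseteq> M" if "Poly_Mapping.keys x \<subseteq> M" for r x :: "('n, 'k) mpoly"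
    using that unfolding class_ring_ideal_iff by blast
  show ?R
  proof (intro ballI allI)
    fix u q assume "u \<in> M"
    then have "Poly_Mapping.keys (mon q * mon u :: ('n, 'k) mpoly) \<subseteq> M"
      by (intro mult) (simp add: mon_def)
    then show "q + u \<in> M" by (simp add: mon_def Poly_Mapping.mult_single)
  qed
next
  assume R: ?R
  show ?L
    unfolding class_ring_ideal_iff
  proof (intro conjI ballI allI)
    fix x y :: "('n, 'k) mpoly"
    assume "x \<in> {f. Poly_Mapping.keys f \<subseteq> M}" "y \<in> {f. Poly_Mapping.keys f \<subseteq> M}"
    then show "x + y \<in> {f. Poly_Mapping.keys f \<subseteq> M}" using Poly_Mapping.keys_add[of x y] by blast
  next
    fix x r :: "('n, 'k) mpoly" assume "x \<in> {f. Poly_Mapping.keys f \<subseteq> M}"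
    then show "r * x \<in> {f. Poly_Mapping.keys f \<subseteq> M}"
      using R Poly_Mapping.keys_mult[of r x] by fastforce
  qed simp
qed

text \<open>The right-hand side is strongly stable and contains \<open>mon u\<close>, so it contains
  the smallest such ideal. Conversely, \<open>Borel (mon u)\<close> contains all dominating
  monomials by \<open>strongly_stable_dominates\<close>, hence their linear combinations.\<close>

lemma Borel_mon: "Borel (mon u) = {f. \<forall>v\<in>Poly_Mapping.keys f. dominates v u}"
proof
  let ?J = "{f. \<forall>v\<in>Poly_Mapping.keys f. dominates v u} :: ('a, 'b) mpoly set"
  have J: "?J = {f. Poly_Mapping.keys f \<subseteq> {v. dominates v u}}" by auto
  have ideal: "ideal ?J class_ring"
    unfolding J ideal_support_iff by (auto intro: dominates_add)
  have "strongly_stable ?J"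
    unfolding strongly_stable_def
  proof (intro conjI allI impI monomial_idealI[OF ideal])
    fix v v' assume "mon v \<in> ?J" "borel_move v v'"
    then show "mon v' \<in> ?J"
      using borel_move_dominates[of v v'] by (auto simp: mon_def dominates_def intro: le_trans)
  qed (auto simp: mon_def)
  then show "Borel (mon u) \<subseteq> ?J"
    unfolding Borel_def by (auto simp: mon_def dominates_def)
  show "?J \<subseteq> Borel (mon u)"
  proof
    fix f assume f: "f \<in> ?J"
    have ideal: "ideal (Borel (mon u) :: ('a, 'b) mpoly set) class_ring"
      using strongly_stable_Borel monomial_idealD(1) by (auto simp: strongly_stable_def)
    have "Poly_Mapping.single v (Poly_Mapping.lookup f v) \<in> Borel (mon u)" if "v \<in> Poly_Mapping.keys f" for v
    proof -
      have "mon v \<in> (Borel (mon u) :: ('a, 'b) mpoly set)"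
        using strongly_stable_dominates[OF strongly_stable_Borel in_Borel_self] f that by blast
      moreover have "Poly_Mapping.single v (Poly_Mapping.lookup f v) = cst (Poly_Mapping.lookup f v) * mon v"
        by (simp add: cst_def mon_def Poly_Mapping.mult_single)
      ultimately show ?thesis using ideal by (simp add: class_ring_ideal_iff)
    qed
    then have "(\<Sum>v\<in>Poly_Mapping.keys f. Poly_Mapping.single v (Poly_Mapping.lookup f v)) \<in> Borel (mon u)"
      by (rule ideal_sum_mem[OF ideal])
    then show "f \<in> Borel (mon u)" by (simp only: sum_single)
  qed
qed

lemma mon_in_Borel_iff:
  "(mon v :: ('n::{finite,linorder}, 'k::comm_ring_1) mpoly) \<in> Borel (mon u) \<longleftrightarrow> dominates v u"
  unfolding Borel_mon by (simp add: mon_def)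

section \<open>Truncation in terms of partial degrees\<close>

lemma sorted_index_list: "sorted (index_list u)"
proof -
  have "sorted (concat (map (\<lambda>i. replicate (f i) i) xs))" if "sorted xs"
    for xs and f :: "'a \<Rightarrow> nat"
    using that by (induction xs) (auto simp: sorted_append sorted_replicate)
  then show ?thesis by (simp add: index_list_def)
qed

lemma length_filter_index_list: "length (filter (\<lambda>i. i \<le> j) (index_list u)) = psum j u"
proof -
  have "length (filter (\<lambda>i. i \<le> j) (concat (map (\<lambda>i. replicate (f i) i) xs))) =
      (\<Sum>i\<leftarrow>xs. if i \<le> j then f i else 0)" for xs and f :: "'a \<Rightarrow> nat"
    by (induction xs) auto
  then have "length (filter (\<lambda>i. i \<le> j) (index_list u)) =
      (\<Sum>i\<in>UNIV. if i \<le> j then Poly_Mapping.lookup u i else 0)"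
    by (simp add: index_list_def sum_list_distinct_conv_sum_set)
  also have "\<dots> = psum j u"
    unfolding psum_def by (intro sum.mono_neutral_cong_right) auto
  finally show ?thesis .
qed

lemma psum_sum_list:
  "psum j (\<Sum>i\<leftarrow>xs. Poly_Mapping.single i 1) = length (filter (\<lambda>i. i \<le> j) xs)"
  by (induction xs) auto

text \<open>In a sorted list the entries up to \<open>j\<close> form an initial segment, so cutting
  the list after \<open>e\<close> entries cuts their number at \<open>e\<close>.\<close>

lemma psum_trunc: "psum j (trunc e u) = min e (psum j u)"
proof -
  have "length (filter (\<lambda>i. i \<le> j) (take e xs)) = min e (length (filter (\<lambda>i. i \<le> j) xs))"
    if "sorted xs" for xs
    using that
  proof (induction xs arbitrary: e)
    case (Cons x xs)
    show ?case
    proof (cases "x \<le> j")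
      case True
      with Cons show ?thesis by (cases e) auto
    next
      case False
      with Cons.prems have "filter (\<lambda>i. i \<le> j) (x # xs) = []" by (auto simp: filter_empty_conv)
      moreover from this have "filter (\<lambda>i. i \<le> j) (take e (x # xs)) = []"
        unfolding filter_empty_conv by (blast dest: in_set_takeD)
      ultimately show ?thesis by simp
    qed
  qed simp
  from this[OF sorted_index_list] show ?thesis
    unfolding trunc_def psum_sum_list length_filter_index_list .
qed

text \<open>At the first index where two vectors differ, their sums below it agree, so the partial
  degrees at that index differ.\<close>

lemma expo_eqI_psum:
  assumes "\<And>j. psum j u = psum j v"
  shows "u = v"
proof (rule ccontr)
  let ?P = "\<lambda>i. Poly_Mapping.lookup u i \<noteq> Poly_Mapping.lookup v i"
  assume "u \<noteq> v"
  then have "\<exists>i. ?P i"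
    using poly_mapping_eqI[of u v] by blast
  from finite_linorder_least[OF this] obtain i where i: "?P i" and less: "\<forall>l<i. \<not> ?P l"
    by (elim exE conjE)
  have "{..i} = insert i {..<i}" by auto
  then have psum: "psum i x = Poly_Mapping.lookup x i + (\<Sum>l<i. Poly_Mapping.lookup x l)" for x
    by (simp add: psum_def)
  have "(\<Sum>l<i. Poly_Mapping.lookup u l) = (\<Sum>l<i. Poly_Mapping.lookup v l)"
    using less by (intro sum.cong) auto
  then have "Poly_Mapping.lookup u i = Poly_Mapping.lookup v i"
    using assms[of i] unfolding psum by (simp only: add_right_cancel)
  then show False using i by contradiction
qed

text \<open>The cofactor is the product of the variables dropped from the index list.\<close>

lemma trunc_dvd: "\<exists>q. u = q + trunc e u"
proof -
  have "u = (\<Sum>i\<leftarrow>index_list u. Poly_Mapping.single i 1)"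
    by (rule expo_eqI_psum) (simp only: psum_sum_list length_filter_index_list)
  also have "\<dots> = (\<Sum>i\<leftarrow>drop e (index_list u). Poly_Mapping.single i 1) + trunc e u"
  proof -
    have "(\<Sum>i\<leftarrow>xs. f i) = (\<Sum>i\<leftarrow>drop e xs. f i) + (\<Sum>i\<leftarrow>take e xs. f i)"
      for xs and f :: "'a \<Rightarrow> 'a expo"
      using arg_cong[OF append_take_drop_id[of e xs], of "\<lambda>xs. \<Sum>i\<leftarrow>xs. f i"]
      unfolding map_append sum_list_append by (simp only: add.commute)
    then show ?thesis unfolding trunc_def .
  qed
  finally show ?thesis ..
qed

lemma psum_eq_tdeg_iff:
  assumes "u \<noteq> 0"
  shows "psum j u = tdeg u \<longleftrightarrow> max_index u \<le> j"
proof -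
  have k: "max_index u \<in> Poly_Mapping.keys u" "\<And>i. i \<in> Poly_Mapping.keys u \<Longrightarrow> i \<le> max_index u"
    using assms unfolding max_index_def by (auto intro: Max_in)
  have "psum j u = tdeg u" if "max_index u \<le> j"
  proof (rule tdeg_eq_psum[symmetric])
    fix i assume "Poly_Mapping.lookup u i \<noteq> 0"
    then show "i \<le> j" using k(2)[of i] that by (simp add: in_keys_iff)
  qed
  moreover have "psum j u \<noteq> tdeg u" if "j < max_index u"
    using k(1) that psum_eq_tdegD[of j u "max_index u"] by (auto simp: in_keys_iff)
  ultimately show ?thesis by (cases "max_index u \<le> j") (simp_all add: not_le)
qed

text \<open>The truncation has degree \<open>s + 1\<close>, so its last variable is number
  \<open>s + 1\<close> in the sorted list of \<open>u\<close>; it has index at most \<open>j\<close>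
  iff more than \<open>s\<close> entries do. Thus \<open>k_s\<close> is the first index at which the
  partial degree exceeds \<open>s\<close>.\<close>

lemma max_index_trunc:
  assumes "s < tdeg u"
  shows "max_index (trunc (s + 1) u) \<le> j \<longleftrightarrow> s < psum j u"
proof -
  let ?t = "trunc (s + 1) u"
  have "s + 1 \<le> psum (Max UNIV) u"
    using assms unfolding tdeg_eq_psum_Max by linarith
  then have deg: "tdeg ?t = s + 1"
    unfolding tdeg_eq_psum_Max psum_trunc by (rule min_absorb1)
  have nonzero: "?t \<noteq> 0"
    using deg tdeg_eq_0_iff[of ?t] by linarith
  have "max_index ?t \<le> j \<longleftrightarrow> psum j ?t = s + 1"
    using psum_eq_tdeg_iff[OF nonzero, of j] unfolding deg by (rule sym)
  also have "\<dots> \<longleftrightarrow> s < psum j u"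
    unfolding psum_trunc by linarith
  finally show ?thesis .
qed

section \<open>Restriction to a set of variables, and supports under \<open>psi\<close>\<close>

lemma lookup_restrict_expo [simp]:
  "Poly_Mapping.lookup (restrict_expo A u) i = (if i \<in> A then Poly_Mapping.lookup u i else 0)"
  by (simp add: restrict_expo_def lookup_sum lookup_single when_def)

lemma restrict_expo_psi: "restrict_expo A (psi_expo w u) = psi_expo w (restrict_expo A u)"
  by (rule poly_mapping_eqI) (simp add: lookup_psi_expo)

lemma psum_restrict_expo: "psum j (restrict_expo {..k} u) = psum (min j k) u"
  unfolding psum_def by (intro sum.mono_neutral_cong_right) auto

lemma tdeg_psi_expo: "tdeg (psi_expo w u) = wdeg w u"
  by (simp add: wdeg_def lookup_psi_expo)

lemma inj_psi_expo:
  assumes "\<And>i. w i > 0"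
  shows "inj (psi_expo w)"
proof (rule injI, rule poly_mapping_eqI)
  fix u v i assume "psi_expo w u = psi_expo w v"
  then have "w i * Poly_Mapping.lookup u i = w i * Poly_Mapping.lookup v i"
    by (metis lookup_psi_expo)
  then show "Poly_Mapping.lookup u i = Poly_Mapping.lookup v i"
    using assms[of i] by simp
qed

text \<open>Positive weights give distinct monomials distinct images, so no terms cancel.\<close>

lemma keys_psi:
  assumes "\<And>i. w i > 0"
  shows "Poly_Mapping.keys (psi w f) = psi_expo w ` Poly_Mapping.keys f"
proof -
  have lookup: "Poly_Mapping.lookup (psi w f) v =
      (\<Sum>u\<in>Poly_Mapping.keys f. if psi_expo w u = v then Poly_Mapping.lookup f u else 0)" for v
    unfolding psi_alt
    by (simp add: lookup_sum cst_def mon_def Poly_Mapping.mult_single lookup_single when_def)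
  have "Poly_Mapping.lookup (psi w f) (psi_expo w u) = Poly_Mapping.lookup f u" for u
    unfolding lookup by (simp add: inj_eq[OF inj_psi_expo[of w, OF assms]] in_keys_iff)
  moreover have "v \<in> psi_expo w ` Poly_Mapping.keys f" if "v \<in> Poly_Mapping.keys (psi w f)" for v
  proof (rule ccontr)
    assume "v \<notin> psi_expo w ` Poly_Mapping.keys f"
    then have "Poly_Mapping.lookup (psi w f) v = 0"
      unfolding lookup by (intro sum.neutral) auto
    then show False using that by (simp add: in_keys_iff)
  qed
  ultimately show ?thesis by (auto simp: in_keys_iff)
qed

section \<open>Truncated Borel ideals and their generators of degree \<open>s\<close>\<close>

text \<open>Truncation caps partial degrees at \<open>s\<close>, so multiples of truncated Borel
  monomials satisfy the capped inequalities. Conversely, the truncation of \<open>v\<close>, which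
  divides \<open>v\<close>, is shown to be the truncation of a Borel monomial
  \<open>x\<close>.\<close>

lemma in_trunc_ideal_Borel_iff:
  "(mon v :: ('n::{finite,linorder}, 'k::comm_ring_1) mpoly) \<in> trunc_ideal s (Borel (mon u)) \<longleftrightarrow>
     (\<forall>j. min s (psum j u) \<le> psum j v)" (is "_ \<longleftrightarrow> ?R") if "s \<le> tdeg u"
proof -
  have gen: "trunc_ideal s (Borel (mon u) :: ('n, 'k) mpoly set) =
      ideal_gen (mon ` trunc s ` {v. dominates v u})"
    unfolding trunc_ideal_def mon_in_Borel_iff by (rule arg_cong[where f = ideal_gen]) auto
  have "(\<exists>x. dominates x u \<and> (\<exists>q. v = q + trunc s x)) \<longleftrightarrow> ?R"
  proof
    assume "\<exists>x. dominates x u \<and> (\<exists>q. v = q + trunc s x)"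
    then obtain x q where x: "dominates x u" "v = q + trunc s x" by blast
    have "min s (psum j u) \<le> min s (psum j x)" for j
      using x(1) by (intro min.mono) (auto simp: dominates_def)
    then show ?R by (simp add: x(2) psum_trunc trans_le_add2)
  next
    assume R: ?R
    let ?t = "trunc s v"
    have t: "min s (psum j u) \<le> psum j ?t" for j
      using R by (simp add: psum_trunc)
    have deg: "tdeg ?t = s"
      using spec[OF R, of "Max UNIV"] that by (simp only: tdeg_eq_psum_Max psum_trunc)
    let ?k = "max_index ?t"
    \<comment> \<open>A high power of the last variable of \<open>?t\<close> lifts all partial
      degrees from there on to at least \<open>tdeg u\<close>, and truncation at \<open>s\<close>
      removes it again. For \<open>s = 0\<close> there is no last variable, and \<open>u\<close>
      itself serves.\<close>
    define x where "x = (if s = 0 then u else ?t + Poly_Mapping.single ?k (tdeg u))"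
    have full: "psum j ?t = s \<longleftrightarrow> ?k \<le> j" if "s \<noteq> 0" for j
    proof -
      have "?t \<noteq> 0" using that tdeg_eq_0_iff[of ?t] deg by simp
      from psum_eq_tdeg_iff[OF this] show ?thesis by (simp only: deg)
    qed
    have "psum j u \<le> psum j x" for j
    proof (cases "?k \<le> j \<or> s = 0")
      case True
      then show ?thesis using psum_le_tdeg[of j u] by (auto simp: x_def)
    next
      case False
      \<comment> \<open>Before \<open>?k\<close> the partial degree of \<open>?t\<close> is below
        \<open>s\<close>, so the minimum in \<open>t\<close> must be
        \<open>psum j u\<close>.\<close>
      then have "psum j ?t < s"
        using full[of j] psum_le_tdeg[of j ?t] by (simp only: deg) simp
      then show ?thesis using t[of j] False by (simp add: x_def)
    qed
    then have "dominates x u" by (simp add: dominates_def)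
    moreover have "trunc s x = ?t"
    proof (rule expo_eqI_psum)
      fix j
      have "psum j ?t \<le> s" using psum_le_tdeg[of j ?t] deg by simp
      then show "psum j (trunc s x) = psum j ?t"
        using full[of j] unfolding psum_trunc[of j s x] by (cases "s = 0"; cases "?k \<le> j") (auto simp: x_def)
    qed
    moreover obtain q where "v = q + ?t" using trunc_dvd by blast
    ultimately show "\<exists>x. dominates x u \<and> (\<exists>q. v = q + trunc s x)" by metis
  qed
  then show ?thesis
    unfolding gen mon_in_ideal_gen_iff by auto
qed

text \<open>All monomials of the truncated ideal have degree at least \<open>s\<close>, so one of
  degree \<open>s\<close> has no proper divisor there. Monomials of the Borel ideal have degree at
  least \<open>tdeg u\<close>, which exceeds \<open>s\<close>.\<close>

lemma min_gens_trunc_ideal_Borel: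
  assumes "s < tdeg u"
  shows "{v \<in> min_gens (trunc_ideal s (Borel (mon u) :: ('n::{finite,linorder}, 'k::comm_ring_1) mpoly set)).
      tdeg v = s \<and> (mon v :: ('n, 'k) mpoly) \<notin> Borel (mon u)} = {v. tdeg v = s \<and> (\<forall>j. min s (psum j u) \<le> psum j v)}"
proof -
  let ?T = "trunc_ideal s (Borel (mon u)) :: ('n, 'k) mpoly set"
  have "monomial_ideal ?T"
    unfolding trunc_ideal_def monomial_ideal_def by (intro exI[of _ "{trunc s v | v. (mon v :: ('n, 'k) mpoly) \<in> Borel (mon u)}"] arg_cong[where f = ideal_gen]) auto
  note min = min_gens_iff[OF this]
  have deg: "s \<le> tdeg v" if "\<forall>j. min s (psum j u) \<le> psum j v" for v
    using spec[OF that, of "Max UNIV"] assms by (simp only: tdeg_eq_psum_Max)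
  have "q = 0" if "\<forall>j. min s (psum j u) \<le> psum j v" "tdeg (q + v) = s" for q v
    using deg[OF that(1)] that(2) tdeg_eq_0_iff[of q] by (simp add: wdeg_add)
  moreover have "\<not> dominates v u" if "tdeg v = s" for v
    using that assms by (auto simp only: dominates_def tdeg_eq_psum_Max not_le not_all)
  ultimately show ?thesis
    using assms unfolding min mon_in_Borel_iff by (auto simp: in_trunc_ideal_Borel_iff)
qed

section \<open>Graded pieces of the quotient by a monomial ideal\<close>

text \<open>A form is congruent to its part supported outside \<open>M\<close>, and a polynomial
  supported outside \<open>M\<close> lies in \<open>I\<close> only if it is zero. So the residues of
  the monomials in \<open>U\<close> form a basis.\<close>

lemma dim_quot_comp:
  fixes M :: "'n::finite expo set" and w :: "'n \<Rightarrow> nat"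
  defines "I \<equiv> {f :: ('n, 'k::field) mpoly. Poly_Mapping.keys f \<subseteq> M}"
  assumes ideal: "ideal I class_ring" and fin: "finite {u. wdeg w u = i}"
  shows "vectorspace.dim (class_ring :: 'k ring) (quot_comp w I i) = card {u. wdeg w u = i \<and> u \<notin> M}"
proof -
  interpret I: ideal I "class_ring :: ('n, 'k) mpoly ring" by fact
  let ?V = "quot_comp w I i"
  let ?r = "a_r_coset class_ring I"
  interpret V: vectorspace "class_ring :: 'k ring" ?V
    by (rule vectorspace_quot_comp[OF ideal])
  define U where "U = {u. wdeg w u = i \<and> u \<notin> M}"
  define b where "b u = ?r (mon u)" for u
  have U: "finite U" unfolding U_def by (rule finite_subset[OF _ fin]) auto
  have r_eq: "?r f = ?r g \<longleftrightarrow> f - g \<in> I" for f g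
  proof
    have "?r h = {a + h | a. a \<in> I}" for h
      by (auto simp: a_r_coset_def r_coset_def)
    moreover have "0 \<in> I" using ideal by (simp add: class_ring_ideal_iff)
    moreover assume "?r f = ?r g"
    ultimately have "f \<in> {a + g | a. a \<in> I}" by (metis (mono_tags, lifting) add_0 mem_Collect_eq)
    then show "f - g \<in> I" by auto
  next
    assume "f - g \<in> I"
    moreover have "f = (f - g) + g" by simp
    ultimately have "f \<in> ?r g"
      unfolding a_r_coset_def r_coset_def by (simp only: UN_iff insert_iff ring_record_simps monoid.simps partial_object.simps) blast
    then show "?r f = ?r g" using I.a_repr_independence' by simp
  qed
  have add: "add (FactRing class_ring I) (?r f) (?r g) = ?r (f + g)" for f g
    using I.a_rcos_sum[of f g] by (simp add: FactRing_def)
  have mult: "mult (FactRing class_ring I) (?r f) (?r g) = ?r (f * g)" for f g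
    using I.rcoset_mult_add[of f g] by (simp add: FactRing_def)
  have zero: "zero (FactRing class_ring I) = ?r 0"
    using I.a_rcos_sum[of 0 0] by (auto simp: FactRing_def a_r_coset_def r_coset_def)
  have car: "carrier ?V = ?r ` homogeneous w i"
    and addV: "?r f \<oplus>\<^bsub>?V\<^esub> ?r g = ?r (f + g)"
    and zeroV: "\<zero>\<^bsub>?V\<^esub> = ?r 0"
    and smultV: "a \<odot>\<^bsub>?V\<^esub> ?r f = ?r (cst a * f)" for f g a
    by (simp_all only: quot_comp_def Let_def partial_object.simps monoid.simps ring.simps module.simps
        add mult zero)
  have cst_mon: "cst a * mon u = (Poly_Mapping.single u a :: ('n, 'k) mpoly)" for a u
    by (simp add: cst_def mon_def Poly_Mapping.mult_single)
  have lookup: "Poly_Mapping.lookup (\<Sum>u\<in>U. Poly_Mapping.single u (c u)) v = (if v \<in> U then c v else 0)"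
    for c :: "'n expo \<Rightarrow> 'k" and v
    using U by (simp add: lookup_sum lookup_single when_def)
  have inj: "inj_on b U"
  proof (rule inj_onI)
    fix u v assume uv: "u \<in> U" "v \<in> U" "b u = b v"
    then have "Poly_Mapping.keys (mon u - mon v :: ('n, 'k) mpoly) \<subseteq> M"
      unfolding b_def r_eq by (simp add: I_def)
    then have "u \<notin> Poly_Mapping.keys (mon u - mon v :: ('n, 'k) mpoly)" using uv by (auto simp: U_def)
    then show "u = v"
      by (auto simp: mon_def in_keys_iff lookup_minus lookup_single when_def split: if_splits)
  qed
  have carrier: "b ` U \<subseteq> carrier ?V"
    unfolding car by (auto simp: b_def U_def homogeneous_def mon_def)
  \<comment> \<open>The coefficients are indexed by residue classes. Injectivity of \<open>b\<close>
    gives one term for each monomial in \<open>U\<close>, so the combination is the class of a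
    single polynomial.\<close>
  have lincomb: "V.lincomb a (b ` U) = ?r (\<Sum>u\<in>U. Poly_Mapping.single u (a (b u)))" for a
  proof -
    have "(\<Oplus>\<^bsub>?V\<^esub>v\<in>b ` A. a v \<odot>\<^bsub>?V\<^esub> v) = ?r (\<Sum>u\<in>A. Poly_Mapping.single u (a (b u)))"
      if "finite A" "A \<subseteq> U" for A
      using that
    proof (induction A)
      case empty
      show ?case by (simp add: zeroV)
    next
      case (insert u A)
      have "b u \<notin> b ` A" using insert inj by (auto simp: inj_on_def)
      moreover have "(\<lambda>v. a v \<odot>\<^bsub>?V\<^esub> v) \<in> b ` insert u A \<rightarrow> carrier ?V"
        using insert.prems carrier by (auto intro!: V.smult_closed)
      ultimately have "(\<Oplus>\<^bsub>?V\<^esub>v\<in>b ` insert u A. a v \<odot>\<^bsub>?V\<^esub> v) =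
          a (b u) \<odot>\<^bsub>?V\<^esub> b u \<oplus>\<^bsub>?V\<^esub> (\<Oplus>\<^bsub>?V\<^esub>v\<in>b ` A. a v \<odot>\<^bsub>?V\<^esub> v)"
        using insert.hyps(1) by (simp add: V.finsum_insert Pi_iff)
      also have "a (b u) \<odot>\<^bsub>?V\<^esub> b u = ?r (Poly_Mapping.single u (a (b u)))"
        by (simp only: b_def smultV cst_mon)
      finally show ?case using insert by (simp add: addV)
    qed
    from this[OF U] show ?thesis by (simp add: V.lincomb_def)
  qed
  have "V.lin_indpt (b ` U)"
  proof (rule V.finite_lin_indpt2[OF finite_imageI[OF U] carrier])
    fix a assume "V.lincomb a (b ` U) = \<zero>\<^bsub>?V\<^esub>"
    then have keys: "Poly_Mapping.keys (\<Sum>u\<in>U. Poly_Mapping.single u (a (b u))) \<subseteq> M"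
      unfolding lincomb zeroV r_eq by (simp add: I_def)
    have "a (b u) = 0" if "u \<in> U" for u
    proof (rule ccontr)
      assume "a (b u) \<noteq> 0"
      then have "u \<in> Poly_Mapping.keys (\<Sum>u\<in>U. Poly_Mapping.single u (a (b u)))"
        using that by (simp add: in_keys_iff lookup)
      then show False using keys that by (auto simp: U_def)
    qed
    then show "\<forall>v\<in>b ` U. a v = \<zero>\<^bsub>class_ring\<^esub>" by simp
  qed
  moreover have "carrier ?V \<subseteq> V.span (b ` U)"
  proof
    fix x assume "x \<in> carrier ?V"
    then obtain f where f: "x = ?r f" "f \<in> homogeneous w i" unfolding car by blast
    \<comment> \<open>The part of \<open>f\<close> outside \<open>M\<close>; the terms of
      \<open>f - ?g\<close> all lie in \<open>M\<close>.\<close>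
    let ?g = "\<Sum>u\<in>U. Poly_Mapping.single u (Poly_Mapping.lookup f u)"
    have "Poly_Mapping.keys (f - ?g) \<subseteq> M"
    proof
      fix v assume "v \<in> Poly_Mapping.keys (f - ?g)"
      then have "v \<in> Poly_Mapping.keys f" "v \<notin> U"
        by (simp_all add: in_keys_iff lookup_minus lookup split: if_splits)
      then show "v \<in> M" using f(2) by (auto simp: homogeneous_def U_def)
    qed
    then have "x = ?r ?g" unfolding f(1) r_eq by (simp add: I_def)
    also have "\<dots> = V.lincomb (\<lambda>v. Poly_Mapping.lookup f (the_inv_into U b v)) (b ` U)"
      unfolding lincomb using inj by (simp add: the_inv_into_f_f)
    finally show "x \<in> V.span (b ` U)"
      unfolding V.finite_span[OF finite_imageI[OF U] carrier] by auto
  qed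
  ultimately have "V.basis (b ` U)"
    unfolding V.basis_def using carrier V.span_is_subset2[OF carrier] by blast
  then have "V.dim = card (b ` U)"
    by (rule V.dim_basis[OF finite_imageI[OF U]])
  then show ?thesis
    using card_image[OF inj] by (simp add: U_def)
qed

section \<open>Counting monomials by weighted degree\<close>

definition expos_on :: "('n::finite \<Rightarrow> nat) \<Rightarrow> 'n set \<Rightarrow> nat \<Rightarrow> 'n expo set" where
  "expos_on w A i = {u. Poly_Mapping.keys u \<subseteq> A \<and> wdeg w u = i}"

lemma finite_wdeg_eq:
  assumes "\<And>i. w i > 0"
  shows "finite {u. wdeg w u = i}"
proof (rule finite_imageD)
  have "Poly_Mapping.lookup u j \<le> wdeg w u" for u j
  proof -
    have "Poly_Mapping.lookup u j \<le> w j * Poly_Mapping.lookup u j" using assms[of j] by simp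
    also have "\<dots> \<le> wdeg w u" unfolding wdeg_def by (rule member_le_sum) auto
    finally show ?thesis .
  qed
  then have "Poly_Mapping.lookup ` {u. wdeg w u = i} \<subseteq> PiE UNIV (\<lambda>_. {..i})" by auto
  then show "finite (Poly_Mapping.lookup ` {u. wdeg w u = i})"
    by (rule finite_subset) (simp add: finite_PiE)
  show "inj_on Poly_Mapping.lookup {u. wdeg w u = i}"
    by (simp add: inj_on_def poly_mapping.lookup_inject)
qed

lemma finite_expos_on: "(\<And>i. w i > 0) \<Longrightarrow> finite (expos_on w A i)"
  by (rule finite_subset[OF _ finite_wdeg_eq[of w i]]) (auto simp: expos_on_def)

lemma wdeg_single: "wdeg w (Poly_Mapping.single j a) = w j * a"
  by (simp add: wdeg_def lookup_single when_def if_distrib cong: if_cong)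

text \<open>Monomials without \<open>x_a\<close> are those on \<open>A\<close>; the others are
  \<open>x_a\<close> times an arbitrary monomial on \<open>insert a A\<close> of degree
  \<open>i - w a\<close>. The case distinction guards the truncated subtraction.\<close>

lemma card_expos_on_insert:
  assumes "\<And>i. w i > 0" "a \<notin> A"
  shows "card (expos_on w (insert a A) i) =
    card (expos_on w A i) + (if i < w a then 0 else card (expos_on w (insert a A) (i - w a)))"
proof -
  let ?e = "Poly_Mapping.single a 1 :: 'a expo"
  have "expos_on w (insert a A) i = expos_on w A i \<union> {u \<in> expos_on w (insert a A) i. Poly_Mapping.lookup u a > 0}"
    by (auto simp: expos_on_def in_keys_iff)
  moreover have "expos_on w A i \<inter> {u \<in> expos_on w (insert a A) i. Poly_Mapping.lookup u a > 0} = {}"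
    using assms(2) by (auto simp: expos_on_def in_keys_iff subset_iff)
  ultimately have card: "card (expos_on w (insert a A) i) =
      card (expos_on w A i) + card {u \<in> expos_on w (insert a A) i. Poly_Mapping.lookup u a > 0}"
    using finite_expos_on[of w, OF assms(1)] by (metis card_Un_disjoint finite_Un)
  have split: "u = (u - ?e) + ?e" if "Poly_Mapping.lookup u a > 0" for u
    using that by (intro poly_mapping_eqI) (auto simp: lookup_add lookup_minus lookup_single when_def)
  show ?thesis
  proof (cases "i < w a")
    case True
    have "wdeg w u \<noteq> i" if "Poly_Mapping.lookup u a > 0" for u
      using arg_cong[OF split[OF that], of "wdeg w"] True by (simp add: wdeg_add wdeg_single)
    then have "{u \<in> expos_on w (insert a A) i. Poly_Mapping.lookup u a > 0} = {}"
      by (auto simp: expos_on_def)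
    then show ?thesis using True card by (simp only: card.empty if_True)
  next
    case False
    have "{u \<in> expos_on w (insert a A) i. Poly_Mapping.lookup u a > 0} =
        (\<lambda>u. u + ?e) ` expos_on w (insert a A) (i - w a)" (is "?S = ?T")
    proof
      show "?S \<subseteq> ?T"
      proof
        fix u assume u: "u \<in> ?S"
        then have eq: "u = (u - ?e) + ?e" using split by blast
        have "wdeg w (u - ?e) = i - w a"
          using arg_cong[OF eq, of "wdeg w"] u
          unfolding wdeg_add wdeg_single expos_on_def by simp linarith
        then have "u - ?e \<in> expos_on w (insert a A) (i - w a)"
          using u by (auto simp: expos_on_def in_keys_iff lookup_minus subset_iff)
        then show "u \<in> ?T" by (rule image_eqI[where f = "\<lambda>u. u + ?e", OF eq])
      qed
      show "?T \<subseteq> ?S"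
      proof
        fix v assume "v \<in> ?T"
        then obtain u where u: "v = u + ?e" "Poly_Mapping.keys u \<subseteq> insert a A" "wdeg w u = i - w a"
          by (auto simp: expos_on_def)
        have "Poly_Mapping.keys v \<subseteq> insert a A"
          using Poly_Mapping.keys_add[of u ?e] u(2) unfolding u(1) by auto
        then show "v \<in> ?S"
          using u(3) False by (simp add: u(1) expos_on_def wdeg_add wdeg_single lookup_add)
      qed
    qed
    then have "card ?S = card (expos_on w (insert a A) (i - w a))"
      by (simp add: card_image)
    then show ?thesis using False card by simp
  qed
qed

text \<open>By \<open>card_expos_on_insert\<close>, multiplying the series of
  \<open>insert a A\<close> by \<open>1 - fps_X ^ w a\<close> gives the series of \<open>A\<close>.
  The whole product thus leads down to the empty set, whose series is 1.\<close>

lemma expos_on_fps: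
  assumes "\<And>i. w i > 0"
  shows "Abs_fps (\<lambda>i. of_nat (card (expos_on w A i))) = (1 :: 'a::field fps) / (\<Prod>j\<in>A. 1 - fps_X ^ w j)"
proof -
  let ?H = "\<lambda>A. Abs_fps (\<lambda>i. of_nat (card (expos_on w A i))) :: 'a fps"
  have "?H A * (\<Prod>j\<in>A. 1 - fps_X ^ w j) = 1" if "finite A"
    using that
  proof (induction A)
    case empty
    have "expos_on w {} i = (if i = 0 then {0} else {})" for i
      by (auto simp: expos_on_def wdeg_def)
    then show ?case by (auto simp: fps_eq_iff)
  next
    case (insert a A)
    have "?H (insert a A) * (1 - fps_X ^ w a) = ?H A"
    proof (rule fps_ext)
      fix i
      show "fps_nth (?H (insert a A) * (1 - fps_X ^ w a)) i = fps_nth (?H A) i"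
        using card_expos_on_insert[of w a A i, OF assms insert.hyps(2)]
        by (simp add: right_diff_distrib fps_X_power_mult_right_nth)
    qed
    then show ?case using insert by (simp add: mult.assoc[symmetric])
  qed
  moreover have "(\<Prod>j\<in>A. 1 - fps_X ^ w j) \<noteq> (0 :: 'a fps)"
  proof -
    have "1 - fps_X ^ w j \<noteq> (0 :: 'a fps)" for j
      using assms[of j] by (auto simp: fps_eq_iff intro!: exI[of _ 0])
    then show ?thesis by simp
  qed
  ultimately show ?thesis
    by (metis finite nonzero_mult_div_cancel_right)
qed

section \<open>Decomposition of the monomials outside the ideal\<close>

text \<open>The classes are indexed by \<open>s\<close> = the degree of the part of \<open>v\<close> in the variables up to the
  first index at which the domination of \<open>u\<close> fails; that index is then \<open>k s\<close>.\<close>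

lemma not_dominates_iff:
  assumes k: "\<And>s j. s < tdeg u \<Longrightarrow> k s \<le> j \<longleftrightarrow> s < psum j u"
  defines "Q \<equiv> \<lambda>s v. psum (k s) v = s \<and> (\<forall>j<k s. psum j u \<le> psum j v)"
  shows "\<not> dominates v u \<longleftrightarrow> (\<exists>s<tdeg u. Q s v)"
    and "s < tdeg u \<Longrightarrow> s' < tdeg u \<Longrightarrow> Q s v \<Longrightarrow> Q s' v \<Longrightarrow> s = s'"
proof -
  show "\<not> dominates v u \<longleftrightarrow> (\<exists>s<tdeg u. Q s v)"
  proof
    assume "\<not> dominates v u"
    then have "\<exists>i. psum i v < psum i u" by (auto simp: dominates_def not_le)
    then obtain j where j: "psum j v < psum j u" and least: "\<And>l. l < j \<Longrightarrow> \<not> psum l v < psum l u"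
      using finite_linorder_least[of "\<lambda>i. psum i v < psum i u"] by blast
    define s where "s = psum j v"
    have s: "s < tdeg u" using j psum_le_tdeg[of j u] by (simp add: s_def)
    \<comment> \<open>By \<open>k\<close>, \<open>k s\<close> is the first index at which the
      partial degree of \<open>u\<close> exceeds \<open>s\<close>. It is at most \<open>j\<close> by
      the choice of \<open>s\<close>, and not before \<open>j\<close>, because there
      \<open>u\<close> is still bounded by \<open>v\<close>, whose partial degree is at most
      \<open>s\<close>.\<close>
    have "k s \<le> j" using j k[OF s] by (simp add: s_def)
    moreover have "\<not> k s < j"
    proof
      assume less: "k s < j"
      have "psum (k s) u \<le> psum (k s) v" using least[OF less] by (simp add: not_less)
      also have "\<dots> \<le> psum j v" by (rule psum_mono[OF less_imp_le[OF less]])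
      finally have "psum (k s) u \<le> s" by (simp only: s_def)
      then show False using k[OF s, of "k s"] by simp
    qed
    ultimately have "k s = j" by simp
    then have "Q s v" using least by (auto simp: Q_def s_def not_less)
    then show "\<exists>s<tdeg u. Q s v" using s by blast
  next
    assume "\<exists>s<tdeg u. Q s v"
    then obtain s where s: "s < tdeg u" "Q s v" by blast
    then have "psum (k s) v < psum (k s) u" using k[of s "k s"] by (simp add: Q_def)
    then show "\<not> dominates v u" by (auto simp: dominates_def not_le)
  qed
next
  \<comment> \<open>If \<open>k s < k s'\<close>, then \<open>Q s' v\<close> bounds
    \<open>psum (k s) u\<close> by \<open>psum (k s) v = s\<close>, whereas \<open>k\<close> makes
    it exceed \<open>s\<close>. By symmetry the two indices agree, and then so do \<open>s\<close>
    and \<open>s'\<close>.\<close>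
  have "\<not> k s < k s'" if "s < tdeg u" "Q s v" "Q s' v" for s s'
    using that k[of s "k s"] by (auto simp: Q_def)
  then show "s = s'" if "s < tdeg u" "s' < tdeg u" "Q s v" "Q s' v"
    using that by (metis Q_def not_less_iff_gr_or_eq)
qed

text \<open>From \<open>k\<close> on, the restriction has constant partial degree
  \<open>psum k v\<close>, and the minimum is \<open>s\<close>. Before \<open>k\<close> the minimum
  is \<open>psum j u\<close>, which is at most \<open>s\<close> there.\<close>

lemma restrict_expo_in_iff:
  assumes k: "\<And>j. k \<le> j \<longleftrightarrow> s < psum j u"
  shows "restrict_expo {..k} v \<in> {v. tdeg v = s \<and> (\<forall>j. min s (psum j u) \<le> psum j v)} \<longleftrightarrow>
    psum k v = s \<and> (\<forall>j<k. psum j u \<le> psum j v)"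
proof -
  have "tdeg (restrict_expo {..k} v) = psum k v"
    by (simp only: tdeg_eq_psum_Max psum_restrict_expo min_absorb2 Max_ge finite UNIV_I)
  moreover have "(\<forall>j. min s (psum j u) \<le> psum (min j k) v) \<longleftrightarrow> (\<forall>j<k. psum j u \<le> psum j v)" if "psum k v = s"
  proof -
    have "min s (psum j u) \<le> psum (min j k) v \<longleftrightarrow> (j < k \<longrightarrow> psum j u \<le> psum j v)" for j
      using k[of j] that by (cases "k \<le> j") (auto simp: min_def)
    then show ?thesis by simp
  qed
  ultimately show ?thesis by (auto simp: psum_restrict_expo)
qed

lemma restrict_expo_split: "u = restrict_expo A u + restrict_expo (- A) u"
  by (rule poly_mapping_eqI) (simp add: lookup_add)

text \<open>Each counted \<open>u\<close> is uniquely the product of a monomial in \<open>C\<close>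
  and an arbitrary monomial in the variables outside \<open>A\<close> carrying the remaining
  degree.\<close>

lemma card_restrict_expo:
  assumes C: "\<And>u. u \<in> C \<Longrightarrow> Poly_Mapping.keys u \<subseteq> A \<and> wdeg w u = s"
  shows "card {u. wdeg w u = i \<and> restrict_expo A u \<in> C} =
    (if i < s then 0 else card C * card (expos_on w (- A) (i - s)))"
proof (cases "i < s")
  case True
  have "restrict_expo A u \<notin> C" if "wdeg w u = i" for u
    using that True arg_cong[OF restrict_expo_split[of u A], of "wdeg w"] C[of "restrict_expo A u"]
    by (auto simp: wdeg_add)
  then show ?thesis using True by (auto simp: card_eq_0_iff)
next
  case False
  have parts: "restrict_expo A (x + y) = x" "restrict_expo (- A) (x + y) = y"
    if "x \<in> C" "y \<in> expos_on w (- A) (i - s)" for x y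
    using C[OF that(1)] that(2)
    by (auto intro!: poly_mapping_eqI simp: lookup_add expos_on_def subset_iff in_keys_iff)
  have "bij_betw (\<lambda>(x, y). x + y) (C \<times> expos_on w (- A) (i - s)) {u. wdeg w u = i \<and> restrict_expo A u \<in> C}"
  proof (rule bij_betwI[where g = "\<lambda>u. (restrict_expo A u, restrict_expo (- A) u)"])
    show "(\<lambda>(x, y). x + y) \<in> C \<times> expos_on w (- A) (i - s) \<rightarrow> {u. wdeg w u = i \<and> restrict_expo A u \<in> C}"
      using False C by (auto simp: parts wdeg_add expos_on_def)
    show "(\<lambda>u. (restrict_expo A u, restrict_expo (- A) u)) \<in>
        {u. wdeg w u = i \<and> restrict_expo A u \<in> C} \<rightarrow> C \<times> expos_on w (- A) (i - s)"
    proof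
      fix u assume "u \<in> {u. wdeg w u = i \<and> restrict_expo A u \<in> C}"
      then have u: "restrict_expo A u \<in> C" "wdeg w u = i" by auto
      have "wdeg w (restrict_expo (- A) u) = wdeg w u - s"
        using arg_cong[OF restrict_expo_split[of u A], of "wdeg w"] C[OF u(1)] by (simp add: wdeg_add)
      moreover have "Poly_Mapping.keys (restrict_expo (- A) u) \<subseteq> - A"
        by (auto simp: in_keys_iff split: if_splits)
      ultimately show "(restrict_expo A u, restrict_expo (- A) u) \<in> C \<times> expos_on w (- A) (i - s)"
        using u by (simp add: expos_on_def)
    qed
  qed (auto simp: parts restrict_expo_split[symmetric])
  then have "card (C \<times> expos_on w (- A) (i - s)) = card {u. wdeg w u = i \<and> restrict_expo A u \<in> C}"
    by (rule bij_betw_same_card)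
  then show ?thesis
    using False by (simp add: card_cartesian_product)
qed

section \<open>The Hilbert series\<close>

theorem theorem3:
  fixes w :: "'n::{finite,linorder} \<Rightarrow> nat"
    and m :: "'n expo"
    and d :: nat
    and I B :: "('n, 'k::field) mpoly set"
    and k :: "nat \<Rightarrow> 'n"
    and G :: "nat \<Rightarrow> 'n expo set"
    and c :: "nat \<Rightarrow> nat"
  assumes "weight_vector w"
    and "wdeg w m = d"
    and "I = principal_stable w (mon m)"
    and "\<And>s. s < d \<Longrightarrow> k s = max_index (trunc (s + 1) (psi_expo w m))"
    and "B = Borel (psi w (mon m))"
    and "\<And>s. s < d \<Longrightarrow> G s = {u \<in> min_gens (trunc_ideal s B). tdeg u = s \<and> mon u \<notin> B}"
    and "\<And>s. s < d \<Longrightarrow> c s = card {u. psi_expo w u \<in> G s}"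
  shows "hilbert_series w I =
    (\<Sum>s<d. fps_const (of_nat (c s)) * fps_X ^ s / (\<Prod>j\<in>{k s<..}. 1 - fps_X ^ w j))"
proof -
  have w: "w i > 0" for i
    using assms(1) by (simp add: weight_vector_def)
  define \<mu> where "\<mu> = psi_expo w m"
  have d: "tdeg \<mu> = d"
    unfolding \<mu>_def tdeg_psi_expo by (rule assms(2))
  have k: "k s \<le> j \<longleftrightarrow> s < psum j \<mu>" if "s < tdeg \<mu>" for s j
    using assms(4)[of s] that max_index_trunc[OF that, of j] unfolding d by (simp only: \<mu>_def)
  have G: "G s = {v. tdeg v = s \<and> (\<forall>j. min s (psum j \<mu>) \<le> psum j v)}" if "s < d" for s
    unfolding assms(6)[OF that] assms(5) psi_mon \<mu>_def[symmetric]
    by (rule min_gens_trunc_ideal_Borel) (use that d in simp)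
  \<comment> \<open>Membership in \<open>I\<close> is a condition on the support alone, as
    \<open>dim_quot_comp\<close> requires.\<close>
  define M where "M = {u. dominates (psi_expo w u) \<mu>}"
  have I: "I = {f. Poly_Mapping.keys f \<subseteq> M}"
    unfolding assms(3) principal_stable_def psi_mon \<mu>_def[symmetric] Borel_mon
    by (auto simp: keys_psi[of w, OF w] M_def)
  define C where "C s = {u. psi_expo w u \<in> G s}" for s
  \<comment> \<open>At \<open>k s\<close> the partial degree of \<open>\<mu>\<close> exceeds
    \<open>s\<close>, so the minimum is \<open>s\<close> and the whole degree of the generator sits
    in the variables up to \<open>k s\<close>.\<close>
  have C: "Poly_Mapping.keys u \<subseteq> {..k s} \<and> wdeg w u = s" if "s < d" "u \<in> C s" for s u
  proof -
    let ?v = "psi_expo w u"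
    have v: "tdeg ?v = s" "min s (psum (k s) \<mu>) \<le> psum (k s) ?v"
      using that G[OF that(1)] by (auto simp: C_def)
    then have "psum (k s) ?v = tdeg ?v"
      using k[of s "k s"] that(1) d psum_le_tdeg[of "k s" ?v] by simp
    then have "Poly_Mapping.lookup u i = 0" if "k s < i" for i
      using psum_eq_tdegD[of "k s" ?v i] that w[of i] by (simp add: lookup_psi_expo)
    then have "Poly_Mapping.keys u \<subseteq> {..k s}"
      by (auto simp: in_keys_iff intro: leI)
    then show ?thesis using v(1) by (simp only: tdeg_psi_expo)
  qed
  let ?Q = "\<lambda>s v. psum (k s) v = s \<and> (\<forall>j<k s. psum j \<mu> \<le> psum j v)"
  \<comment> \<open>Restriction commutes with \<open>psi_expo\<close>, so the classes of monomials
    of \<open>R\<close> pull back to conditions on restrictions in \<open>S\<close>.\<close>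
  have C_iff: "restrict_expo {..k s} u \<in> C s \<longleftrightarrow> ?Q s (psi_expo w u)" if "s < d" for s u
    using restrict_expo_in_iff[of "k s" s \<mu> "psi_expo w u"] k[of s] that
    unfolding C_def G[OF that] d restrict_expo_psi by blast
  let ?D = "\<lambda>s i. {u. wdeg w u = i \<and> restrict_expo {..k s} u \<in> C s}"
  have "{u. wdeg w u = i \<and> u \<notin> M} = (\<Union>s<d. ?D s i)" for i
    using not_dominates_iff(1)[of \<mu> k, OF k] unfolding d M_def by (auto simp: C_iff)
  moreover have "card (\<Union>s<d. ?D s i) = (\<Sum>s<d. card (?D s i))" for i
  proof (rule card_UN_disjoint)
    show "\<forall>s\<in>{..<d}. finite (?D s i)"
      by (auto intro: finite_subset[OF _ finite_wdeg_eq[of w i, OF w]])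
    show "\<forall>s\<in>{..<d}. \<forall>s'\<in>{..<d}. s \<noteq> s' \<longrightarrow> ?D s i \<inter> ?D s' i = {}"
      using not_dominates_iff(2)[of \<mu> k, OF k] unfolding d by (auto simp: C_iff)
  qed simp
  moreover have "card (?D s i) = (if i < s then 0 else c s * card (expos_on w {k s<..} (i - s)))"
    if "s < d" for s i
    using card_restrict_expo[of "C s" "{..k s}" w s i] C[OF that] assms(7)[OF that]
    by (simp add: C_def Compl_atMost)
  ultimately have card: "card {u. wdeg w u = i \<and> u \<notin> M} =
      (\<Sum>s<d. if i < s then 0 else c s * card (expos_on w {k s<..} (i - s)))" for i
    by simp
  have ideal: "ideal {f :: ('n, 'k) mpoly. Poly_Mapping.keys f \<subseteq> M} class_ring"
    using ideal_principal_stable[of w "mon m :: ('n, 'k) mpoly"] unfolding assms(3)[symmetric] I .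
  have "hilbert_series w I = Abs_fps (\<lambda>i. of_nat (card {u. wdeg w u = i \<and> u \<notin> M}))"
    unfolding hilbert_series_def I
    by (simp only: dim_quot_comp[OF ideal finite_wdeg_eq[of w, OF w]])
  \<comment> \<open>The factor \<open>fps_X ^ s\<close> shifts coefficients by \<open>s\<close>,
    which accounts for the zero terms with \<open>i < s\<close>.\<close>
  also have "\<dots> = (\<Sum>s<d. fps_const (of_nat (c s)) * fps_X ^ s *
      Abs_fps (\<lambda>i. of_nat (card (expos_on w {k s<..} i))))"
    by (rule fps_ext)
      (simp add: card fps_sum_nth fps_X_power_mult_nth mult.assoc if_distrib cong: if_cong)
  also have "\<dots> = (\<Sum>s<d. fps_const (of_nat (c s)) * fps_X ^ s / (\<Prod>j\<in>{k s<..}. 1 - fps_X ^ w j))"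
    unfolding expos_on_fps[of w, OF w]
  proof (rule sum.cong[OF refl])
    fix s
    \<comment> \<open>With constant term 1 the denominator is a unit, so the factor in front may be
      moved into the quotient.\<close>
    have "fps_nth (\<Prod>j\<in>A. 1 - fps_X ^ w j :: rat fps) 0 = 1" for A
      using w by (induction A rule: infinite_finite_induct) auto
    then have "(\<Prod>j\<in>{k s<..}. 1 - fps_X ^ w j) dvd (1 :: rat fps)"
      by (simp add: fps_is_unit_iff)
    then show "fps_const (of_nat (c s)) * fps_X ^ s * (1 / (\<Prod>j\<in>{k s<..}. 1 - fps_X ^ w j)) =
        fps_const (of_nat (c s)) * fps_X ^ s / (\<Prod>j\<in>{k s<..}. 1 - fps_X ^ w j :: rat fps)"
      by (simp add: div_mult_swap)
  qed
  finally show ?thesis .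
qed

end
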